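(* Let $r\in\mathbb R$ and $n\ge \frac15$. Let $\mu_0,\mu_1,\dots,\mu_\ell$ be the sequence of distributions obtained by applying a weight-constrained sequence of moves to an initial distribution $\mu_0$ with $\mu_0\{x>r\}=0$. If $\mu_{\max}\{x>r\}\le n$, then $\mu_{\max}\{x>r+6n^{1/3}-1\}=0$.
   Context: A (discrete mass) distribution is a finite set $\mu=\{(x_1,m_1),\dots,(x_k,m_k)\}$ with $x_i\in\mathbb R$ and $m_i>0$; a signed distribution is the same without the positivity requirement. For $A\subseteq\mathbb R$, $\mu(A)=\sum_{x_i\in A}m_i$, and $\mu\{x>a\}$ means $\mu(\{x:x>a\})$, etc. Moments: $M_j[\mu]=\sum_i m_ix_i^j$. A move $v=([a,b],\delta)$ consists of an interval with $b-a=1$ and a signed distribution $\delta$ supported in $[a,b]$ with $M_0[\delta]=M_1[\delta]=0$; its center is $\frac{a+b}2$. It can be applied to $\mu$ if $\mu+\delta$ is a distribution, and then $v\mu=\mu+\delta$. A sequence of moves $v_1,\dots,v_\ell$ applied to $\mu_0$ produces $\mu_i=v_i\mu_{i-1}$. For such a sequence, $\mu_{\max}\{x>a\}=\max_{0\le i\le\ell}\mu_i\{x>a\}$ (similarly for $\ge$). The sequence is weight-constrained (with respect to $\mu_0$) if for every $a\in\mathbb R$ the number of moves whose center lies in $(a,\infty)$ is at most $\mu_{\max}\{x>a\}$. *)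

theory Defs
  imports Complex_Main
begin

text \<open>A (signed) distribution is represented by its mass function
  \<open>real \<Rightarrow> real\<close> with finite support: the point x carries mass \<open>mu x\<close>
  (points with mass 0 are not part of the distribution).\<close>

definition signed_dist :: "(real \<Rightarrow> real) \<Rightarrow> bool" where
  "signed_dist d \<longleftrightarrow> finite {x. d x \<noteq> 0}"

definition is_dist :: "(real \<Rightarrow> real) \<Rightarrow> bool" where
  "is_dist mu \<longleftrightarrow> signed_dist mu \<and> (\<forall>x. 0 \<le> mu x)"

definition mass :: "(real \<Rightarrow> real) \<Rightarrow> real set \<Rightarrow> real" where
  "mass mu A = (\<Sum>x \<in> {x. mu x \<noteq> 0} \<inter> A. mu x)"

definition moment :: "nat \<Rightarrow> (real \<Rightarrow> real) \<Rightarrow> real" where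
  "moment j mu = (\<Sum>x \<in> {x. mu x \<noteq> 0}. mu x * x ^ j)"

definition is_move :: "real \<times> (real \<Rightarrow> real) \<Rightarrow> bool" where
  "is_move v \<longleftrightarrow> signed_dist (snd v)
     \<and> (\<forall>x. snd v x \<noteq> 0 \<longrightarrow> fst v \<le> x \<and> x \<le> fst v + 1)
     \<and> moment 0 (snd v) = 0 \<and> moment 1 (snd v) = 0"

definition center :: "real \<times> (real \<Rightarrow> real) \<Rightarrow> real" where
  "center v = fst v + 1/2"

definition seq_dist :: "(real \<Rightarrow> real) \<Rightarrow> (real \<times> (real \<Rightarrow> real)) list \<Rightarrow> nat \<Rightarrow> real \<Rightarrow> real" where
  "seq_dist mu0 vs i = (\<lambda>x. mu0 x + (\<Sum>j<i. snd (vs ! j) x))"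

definition valid_seq :: "(real \<Rightarrow> real) \<Rightarrow> (real \<times> (real \<Rightarrow> real)) list \<Rightarrow> bool" where
  "valid_seq mu0 vs \<longleftrightarrow> (\<forall>v \<in> set vs. is_move v)
     \<and> (\<forall>i \<le> length vs. is_dist (seq_dist mu0 vs i))"

definition mu_max :: "(real \<Rightarrow> real) \<Rightarrow> (real \<times> (real \<Rightarrow> real)) list \<Rightarrow> real set \<Rightarrow> real" where
  "mu_max mu0 vs A = Max ((\<lambda>i. mass (seq_dist mu0 vs i) A) ` {0..length vs})"

definition weight_constrained :: "(real \<Rightarrow> real) \<Rightarrow> (real \<times> (real \<Rightarrow> real)) list \<Rightarrow> bool" where
  "weight_constrained mu0 vs \<longleftrightarrow>
     (\<forall>a. real (card {i. i < length vs \<and> center (vs ! i) > a}) \<le> mu_max mu0 vs {a<..})"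

end

theory Submission
  imports Defs "HOL-Analysis.Analysis"
begin

text \<open>
  Put \<open>s = n powr (1/3)\<close>. If \<open>s \<le> 9/4\<close>, then the at most \<open>n\<close> moves centred beyond \<open>r\<close> carry mass at most
  to \<open>r + n + 1/2 \<le> r + 6 s - 1\<close>. Otherwise at most mass \<open>n/8\<close> ever gets beyond \<open>r + 3 s\<close>, and the argument
  is repeated with \<open>(r + 3 s, n/8)\<close>, that is with \<open>s/2\<close> for \<open>s\<close>.

  To bound the mass beyond \<open>r + 3 s\<close>, consider the convex function \<open>U y = \<Sum>x. \<mu> x * (x - y)\<^sup>+\<close>. A move on
  \<open>[a, a + 1]\<close> changes \<open>U\<close> only inside the interval, where it stays below the chord, and the slope of \<open>U\<close>
  beyond \<open>r\<close> is at least \<open>-n\<close>. With \<open>z = r + 1\<close> it follows that \<open>U y \<le> \<integral>\<^sub>y G\<close>, where the decreasing function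
  \<open>G\<close>, equal to \<open>n\<close> left of \<open>z\<close> and initially 0 right of \<open>z\<close>, is averaged over \<open>[a, a + 1]\<close> and then reset to \<open>n\<close>
  left of \<open>z\<close> at each move that reaches beyond \<open>z\<close>. For every slope \<open>c\<close>, such a step lowers the energy
  \<open>\<integral> G (2 n - G - 2 c (y - z)\<^sup>+)\<close> by at most \<open>c\<^sup>2/12\<close>, and there are at most \<open>n\<close> of them. On the other hand,
  for \<open>0 < b < c\<close> the energy exceeds its initial value \<open>n\<^sup>2\<close> by at most \<open>n\<^sup>3/(3 b) - 2 (c - b) M\<close>, where
  \<open>M = \<integral> G (y - z)\<^sup>+\<close> is at least \<open>3 e\<^sup>2\<close> times the mass beyond \<open>z + 3 e\<close>. The choice \<open>b = 3/4 * s\<^sup>2\<close>, \<open>c = 3 s\<^sup>2\<close>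
  is close to optimal.
\<close>

section \<open>Weighted sums over a distribution\<close>

definition weighted_sum :: "(real \<Rightarrow> real) \<Rightarrow> (real \<Rightarrow> real) \<Rightarrow> real" where
  "weighted_sum mu f = (\<Sum>x | mu x \<noteq> 0. mu x * f x)"

lemma weighted_sum_superset:
  assumes "finite S" "{x. mu x \<noteq> 0} \<subseteq> S"
  shows "weighted_sum mu f = (\<Sum>x\<in>S. mu x * f x)"
  unfolding weighted_sum_def by (rule sum.mono_neutral_left) (use assms in auto)

lemma weighted_sum_add_dist:
  assumes "signed_dist mu" "signed_dist d"
  shows "weighted_sum (\<lambda>x. mu x + d x) f = weighted_sum mu f + weighted_sum d f"
proof -
  have finite: "finite ({x. mu x \<noteq> 0} \<union> {x. d x \<noteq> 0})"
    using assms by (simp add: signed_dist_def)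
  show ?thesis
    by (subst (1 2 3) weighted_sum_superset[OF finite]) (auto simp: sum.distrib distrib_right)
qed

lemma weighted_sum_add: "weighted_sum mu (\<lambda>x. f x + g x) = weighted_sum mu f + weighted_sum mu g"
  by (simp add: weighted_sum_def distrib_left sum.distrib)

lemma weighted_sum_diff: "weighted_sum mu (\<lambda>x. f x - g x) = weighted_sum mu f - weighted_sum mu g"
  by (simp add: weighted_sum_def right_diff_distrib sum_subtractf)

lemma weighted_sum_cmult: "weighted_sum mu (\<lambda>x. c * f x) = c * weighted_sum mu f"
  by (simp add: weighted_sum_def sum_distrib_left mult.left_commute)

lemma weighted_sum_cong:
  assumes "\<And>x. mu x \<noteq> 0 \<Longrightarrow> f x = g x"
  shows "weighted_sum mu f = weighted_sum mu g"
  unfolding weighted_sum_def using assms by (intro sum.cong) auto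

lemma weighted_sum_mono:
  assumes "is_dist mu" "\<And>x. f x \<le> g x"
  shows "weighted_sum mu f \<le> weighted_sum mu g"
  unfolding weighted_sum_def using assms
  by (intro sum_mono mult_left_mono) (auto simp: is_dist_def)

lemma weighted_sum_eq_0_iff:
  assumes "is_dist mu" "\<And>x. 0 \<le> f x"
  shows "weighted_sum mu f = 0 \<longleftrightarrow> (\<forall>x. mu x \<noteq> 0 \<longrightarrow> f x = 0)"
  unfolding weighted_sum_def using assms
  by (subst sum_nonneg_eq_0_iff) (auto simp: is_dist_def signed_dist_def)

lemma moment_eq_weighted_sum: "moment j mu = weighted_sum mu (\<lambda>x. x ^ j)"
  by (simp add: moment_def weighted_sum_def)

lemma mass_eq_weighted_sum:
  assumes "signed_dist mu"
  shows "mass mu A = weighted_sum mu (indicat_real A)"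
proof -
  have "mass mu A = (\<Sum>x | mu x \<noteq> 0. if x \<in> A then mu x else 0)"
    unfolding mass_def using assms by (intro sum.inter_restrict) (simp add: signed_dist_def)
  also have "\<dots> = weighted_sum mu (indicat_real A)"
    unfolding weighted_sum_def by (rule sum.cong) (auto simp: indicator_def)
  finally show ?thesis .
qed

lemma mass_nonneg: "is_dist mu \<Longrightarrow> 0 \<le> mass mu A"
  unfolding mass_def by (intro sum_nonneg) (simp add: is_dist_def)

lemma mass_mono:
  assumes "is_dist mu" "A \<subseteq> B"
  shows "mass mu A \<le> mass mu B"
proof -
  have "weighted_sum mu (indicat_real A) \<le> weighted_sum mu (indicat_real B)"
    using assms by (intro weighted_sum_mono) (auto simp: indicator_def)
  then show ?thesis
    using assms(1) by (simp add: is_dist_def mass_eq_weighted_sum)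
qed

section \<open>The excess function\<close>

definition excess :: "(real \<Rightarrow> real) \<Rightarrow> real \<Rightarrow> real" where
  "excess mu y = weighted_sum mu (\<lambda>x. max 0 (x - y))"

lemma excess_nonneg: "is_dist mu \<Longrightarrow> 0 \<le> excess mu y"
  unfolding excess_def weighted_sum_def by (intro sum_nonneg) (simp add: is_dist_def)

lemma excess_antimono:
  assumes "is_dist mu" "x \<le> y"
  shows "excess mu y \<le> excess mu x"
  unfolding excess_def using assms by (intro weighted_sum_mono) auto

lemma excess_eq_0_mono:
  assumes "is_dist mu" "excess mu x = 0" "x \<le> y"
  shows "excess mu y = 0"
  using excess_antimono[OF assms(1,3)] excess_nonneg[OF assms(1), of y] assms(2) by simp

lemma excess_le_chord:
  assumes "is_dist mu" "a \<le> y" "y \<le> b"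
  shows "(b - a) * excess mu y \<le> (b - y) * excess mu a + (y - a) * excess mu b"
proof -
  have "(b - a) * max 0 (x - y) \<le> (b - y) * max 0 (x - a) + (y - a) * max 0 (x - b)" for x
  proof -
    have "(b - a) * max 0 (x - y) = max 0 ((b - a) * (x - y))"
      using assms(2,3) by (simp add: max_mult_distrib_left)
    also have "(b - a) * (x - y) = (b - y) * (x - a) + (y - a) * (x - b)"
      by algebra
    also have "\<dots> \<le> (b - y) * max 0 (x - a) + (y - a) * max 0 (x - b)"
      using assms(2,3) by (intro add_mono mult_left_mono) auto
    finally show ?thesis
      using assms(2,3) by simp
  qed
  then show ?thesis
    unfolding excess_def using assms(1)
    by (simp add: weighted_sum_mono flip: weighted_sum_add weighted_sum_cmult)
qed

lemma excess_le_excess_plus_mass: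
  assumes "is_dist mu" "y \<le> z"
  shows "excess mu y \<le> excess mu z + (z - y) * mass mu {y<..}"
proof -
  have "excess mu y \<le> weighted_sum mu (\<lambda>x. max 0 (x - z) + (z - y) * indicat_real {y<..} x)"
    unfolding excess_def using assms by (intro weighted_sum_mono) (auto simp: indicator_def)
  also have "\<dots> = excess mu z + (z - y) * mass mu {y<..}"
    using assms(1)
    by (simp add: excess_def weighted_sum_add weighted_sum_cmult mass_eq_weighted_sum is_dist_def)
  finally show ?thesis .
qed

lemma mass_le_excess:
  assumes "is_dist mu" "y \<le> z"
  shows "(z - y) * mass mu {z<..} \<le> excess mu y"
proof -
  have "(z - y) * mass mu {z<..} = weighted_sum mu (\<lambda>x. (z - y) * indicat_real {z<..} x)"
    using assms(1) by (simp add: weighted_sum_cmult mass_eq_weighted_sum is_dist_def)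
  also have "\<dots> \<le> excess mu y"
    unfolding excess_def using assms by (intro weighted_sum_mono) (auto simp: indicator_def)
  finally show ?thesis .
qed

lemma mass_eq_0_iff_excess_eq_0:
  assumes "is_dist mu"
  shows "mass mu {a<..} = 0 \<longleftrightarrow> excess mu a = 0"
proof -
  have "mass mu {a<..} = 0 \<longleftrightarrow> (\<forall>x. mu x \<noteq> 0 \<longrightarrow> x \<le> a)"
    using assms weighted_sum_eq_0_iff[OF assms, of "indicat_real {a<..}"]
    by (auto simp: mass_eq_weighted_sum is_dist_def indicator_eq_0_iff not_less)
  moreover have "max 0 (x - a) = 0 \<longleftrightarrow> x \<le> a" for x
    by auto
  ultimately show ?thesis
    using weighted_sum_eq_0_iff[OF assms, of "\<lambda>x. max 0 (x - a)"] by (simp add: excess_def)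
qed

section \<open>Moves\<close>

definition apply_move :: "real \<times> (real \<Rightarrow> real) \<Rightarrow> (real \<Rightarrow> real) \<Rightarrow> real \<Rightarrow> real" where
  "apply_move v mu = (\<lambda>x. mu x + snd v x)"

lemma excess_move_eq_0:
  assumes "is_move v" "y \<le> fst v \<or> fst v + 1 \<le> y"
  shows "excess (snd v) y = 0"
  using assms(2)
proof
  assume "y \<le> fst v"
  then have "excess (snd v) y = weighted_sum (snd v) (\<lambda>x. x ^ 1 - y * x ^ 0)"
    unfolding excess_def using assms(1) by (intro weighted_sum_cong) (force simp: is_move_def)
  also have "\<dots> = moment 1 (snd v) - y * moment 0 (snd v)"
    by (simp only: weighted_sum_diff weighted_sum_cmult moment_eq_weighted_sum)
  finally show ?thesis
    using assms(1) by (simp add: is_move_def)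
next
  assume "fst v + 1 \<le> y"
  then show ?thesis
    unfolding excess_def weighted_sum_def using assms(1)
    by (intro sum.neutral) (force simp: is_move_def)
qed

lemma excess_apply_move_outside:
  assumes "is_move v" "is_dist mu" "y \<le> fst v \<or> fst v + 1 \<le> y"
  shows "excess (apply_move v mu) y = excess mu y"
proof -
  have "excess (apply_move v mu) y = excess mu y + excess (snd v) y"
    unfolding excess_def apply_move_def using assms(1,2)
    by (intro weighted_sum_add_dist) (auto simp: is_move_def is_dist_def)
  then show ?thesis
    using excess_move_eq_0[OF assms(1,3)] by simp
qed

lemma excess_apply_move_le_chord:
  assumes "is_move v" "is_dist mu" "is_dist (apply_move v mu)" "fst v \<le> y" "y \<le> fst v + 1"
  shows "excess (apply_move v mu) y
    \<le> (fst v + 1 - y) * excess mu (fst v) + (y - fst v) * excess mu (fst v + 1)"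
  using excess_le_chord[OF assms(3-5)] by (simp add: excess_apply_move_outside[OF assms(1,2)])

lemma excess_apply_move_shift_eq_0:
  assumes "is_move v" "is_dist mu" "is_dist (apply_move v mu)" "excess mu y = 0"
  shows "excess (apply_move v mu) (y + 1) = 0"
proof (cases "y + 1 \<le> fst v \<or> fst v \<le> y")
  case True
  then show ?thesis
    using excess_apply_move_outside[OF assms(1,2)] excess_eq_0_mono[OF assms(2,4)] by simp
next
  case False
  then have "excess (apply_move v mu) (y + 1) \<le> 0"
    using excess_apply_move_le_chord[OF assms(1-3), of "y + 1"] excess_eq_0_mono[OF assms(2,4)]
    by simp
  then show ?thesis
    using excess_nonneg[OF assms(3)] by (simp add: order_antisym)
qed

section \<open>Profiles\<close>

locale profile =
  fixes n z :: real and G :: "real \<Rightarrow> real"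
  assumes antimono: "antimono G"
    and eq_height: "y \<le> z \<Longrightarrow> G y = n"
    and nonneg: "0 \<le> G y"
begin

lemma le_height: "G y \<le> n"
  using antimonoD[OF antimono, of "min y z" y] eq_height[of "min y z"] by simp

lemma absolutely_integrable_on: "G absolutely_integrable_on {a..b}"
proof (rule nonnegative_absolutely_integrable_1)
  have "(\<lambda>y. - G y) integrable_on {a..b}"
    using antimono by (intro integrable_on_mono_on) (auto simp: antimono_def mono_on_def)
  then show "G integrable_on {a..b}"
    by (simp add: integrable_neg_iff)
qed (rule nonneg)

lemma integrable_on: "G integrable_on {a..b}"
  using absolutely_integrable_on by (rule set_lebesgue_integral_eq_integral(1))

lemma mult_integrable_on:
  assumes "h absolutely_integrable_on {a..b}"
  shows "(\<lambda>y. G y * h y) integrable_on {a..b}"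
proof (intro set_lebesgue_integral_eq_integral(1) absolutely_integrable_bounded_measurable_product_real)
  show "G \<in> borel_measurable (lebesgue_on {a..b})"
    using absolutely_integrable_on by (simp add: absolutely_integrable_measurable)
  show "bounded (G ` {a..b})"
    by (rule boundedI[of _ n]) (use nonneg le_height in auto)
qed (use assms in auto)

lemma integral_split:
  assumes "a \<le> b" "b \<le> c"
  shows "integral {a..c} G = integral {a..b} G + integral {b..c} G"
  using Henstock_Kurzweil_Integration.integral_combine[OF assms integrable_on] by simp

end

abbreviation unit_mean :: "real \<Rightarrow> (real \<Rightarrow> real) \<Rightarrow> real" where
  "unit_mean a G \<equiv> integral {a..a+1} G"

text \<open>Averaging over \<open>[a, a + 1]\<close> is what the most spreading move on that interval does to the tail
  function of a distribution; resetting the value left of \<open>z\<close> replaces mass that fell off to the left.\<close>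

definition spread :: "real \<Rightarrow> real \<Rightarrow> real \<Rightarrow> (real \<Rightarrow> real) \<Rightarrow> real \<Rightarrow> real" where
  "spread n z a G y = (if y \<le> z then n else if y \<in> {a..a+1} then unit_mean a G else G y)"

context profile
begin

lemma unit_mean_le: "unit_mean a G \<le> G a"
proof -
  have "unit_mean a G \<le> unit_mean a (\<lambda>_. G a)"
    by (intro integral_le integrable_on) (auto intro: antimonoD[OF antimono])
  then show ?thesis
    by simp
qed

lemma le_unit_mean: "G (a + 1) \<le> unit_mean a G"
proof -
  have "unit_mean a (\<lambda>_. G (a + 1)) \<le> unit_mean a G"
    by (intro integral_le integrable_on) (auto intro: antimonoD[OF antimono])
  then show ?thesis
    by simp
qed

lemma unit_mean_le_height: "unit_mean a G \<le> n"
  using unit_mean_le le_height by (rule order_trans)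

lemma profile_spread: "profile n z (spread n z a G)"
proof
  have "unit_mean a G \<le> G x" if "x \<le> a" for x
    using unit_mean_le[of a] antimonoD[OF antimono that] by simp
  moreover have "G x \<le> unit_mean a G" if "a + 1 \<le> x" for x
    using le_unit_mean[of a] antimonoD[OF antimono that] by simp
  ultimately show "antimono (spread n z a G)"
    using le_height unit_mean_le_height antimonoD[OF antimono]
    by (auto simp: antimono_def spread_def)
  show "0 \<le> spread n z a G y" for y
    using order_trans[OF nonneg le_height] order_trans[OF nonneg le_unit_mean] nonneg
    by (simp add: spread_def)
qed (simp add: spread_def)

lemma integral_spread_right:
  assumes "a + 1 \<le> y"
  shows "integral {y..L} G \<le> integral {y..L} (spread n z a G)"
proof (intro integral_le integrable_on profile.integrable_on[OF profile_spread])
  fix x assume "x \<in> {y..L}"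
  then show "G x \<le> spread n z a G x"
    using assms le_height le_unit_mean[of a]
    by (auto simp: spread_def dest!: order_antisym[of x "a + 1"])
qed

lemma integral_spread_inside:
  assumes "a \<le> y" "y \<le> a + 1" "a + 1 \<le> L"
  shows "(a + 1 - y) * unit_mean a G + integral {a+1..L} G \<le> integral {y..L} (spread n z a G)"
proof -
  have "integral {y..a+1} (\<lambda>_. unit_mean a G) \<le> integral {y..a+1} (spread n z a G)"
    using assms(1) unit_mean_le_height
    by (intro integral_le profile.integrable_on[OF profile_spread]) (auto simp: spread_def)
  then show ?thesis
    using assms(2) integral_spread_right[of a "a + 1" L]
      profile.integral_split[OF profile_spread assms(2,3)]
    by simp
qed

lemma integral_spread_left:
  assumes "y \<le> a" "a + 1 \<le> L"
  shows "integral {y..L} G \<le> integral {y..L} (spread n z a G)"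
proof -
  have "integral {y..a} (spread n z a G) = integral {y..a} G"
    using eq_height by (intro integral_spike[of "{a}"]) (auto simp: spread_def)
  moreover have "integral {a..L} G \<le> integral {a..L} (spread n z a G)"
    using integral_spread_inside[of a a L] integral_split[of a "a + 1" L] assms(2) by simp
  ultimately show ?thesis
    using assms integral_split[of y a L] profile.integral_split[OF profile_spread, of y a L] by simp
qed

end

section \<open>The energy of a profile\<close>

definition energy_density :: "real \<Rightarrow> real \<Rightarrow> real \<Rightarrow> (real \<Rightarrow> real) \<Rightarrow> real \<Rightarrow> real" where
  "energy_density n c z G y = G y * (2 * n - G y - 2 * c * max 0 (y - z))"

lemma has_integral_centered_square:
  fixes a b :: real
  assumes "a \<le> b"
  shows "((\<lambda>y. (y - (a + b) / 2)^2) has_integral (b - a)^3 / 12) {a..b}"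
proof -
  have "((\<lambda>y. (y - (a + b) / 2)^2) has_integral
      (b - (a + b) / 2)^3 / 3 - (a - (a + b) / 2)^3 / 3) {a..b}"
    using assms by (intro fundamental_theorem_of_calculus)
      (auto intro!: derivative_eq_intros simp flip: has_real_derivative_iff_has_vector_derivative)
  moreover have "(b - (a + b) / 2)^3 / 3 - (a - (a + b) / 2)^3 / 3 = (b - a)^3 / 12"
    by (simp add: power3_eq_cube field_simps)
  ultimately show ?thesis
    by simp
qed

lemma has_real_derivative_max_0_cube:
  fixes x :: real
  assumes "x \<noteq> 0"
  shows "((\<lambda>x. max 0 x ^ 3) has_real_derivative 3 * (max 0 x)^2) (at x)"
proof (cases "x > 0")
  case True
  have "((\<lambda>x::real. x ^ 3) has_real_derivative 3 * (max 0 x)^2) (at x)"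
    using True by (auto intro!: derivative_eq_intros)
  then show ?thesis
    by (rule has_field_derivative_transform_within_open[of _ _ _ "{0<..}"]) (use True in auto)
next
  case False
  then have "((\<lambda>_. 0) has_real_derivative 3 * (max 0 x)^2) (at x)"
    by simp
  then show ?thesis
    by (rule has_field_derivative_transform_within_open[of _ _ _ "{..<0}"]) (use False assms in auto)
qed

lemma integral_positive_part_square_le:
  fixes n b z L :: real
  assumes "b > 0" "n \<ge> 0" "z \<le> L"
  defines "q \<equiv> \<lambda>y. n - b * (y - z)"
  shows "(\<lambda>y. (max 0 (q y))^2) integrable_on {z..L}"
    and "integral {z..L} (\<lambda>y. (max 0 (q y))^2) \<le> n^3 / (3 * b)"
proof -
  let ?F = "\<lambda>y. - ((max 0 (q y))^3 / (3 * b))"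
  have square: "((\<lambda>y. (max 0 (q y))^2) has_integral ?F L - ?F z) {z..L}"
  proof (rule fundamental_theorem_of_calculus_interior_strong[of "{z + n / b}"])
    show "continuous_on {z..L} ?F"
      using assms(1) unfolding q_def by (intro continuous_intros) auto
    fix y assume "y \<in> {z<..<L} - {z + n / b}"
    then have "q y \<noteq> 0"
      using assms(1) by (auto simp: q_def field_simps)
    moreover have "(q has_real_derivative - b) (at y)"
      unfolding q_def by (auto intro!: derivative_eq_intros)
    ultimately have "((\<lambda>y. (max 0 (q y))^3) has_real_derivative 3 * (max 0 (q y))^2 * - b) (at y)"
      by (intro DERIV_chain2[OF has_real_derivative_max_0_cube])
    from DERIV_minus[OF DERIV_cdivide[OF this, of "3 * b"]]
    show "(?F has_vector_derivative (max 0 (q y))^2) (at y)"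
      using assms(1) by (simp add: has_real_derivative_iff_has_vector_derivative)
  qed (use assms in auto)
  show "(\<lambda>y. (max 0 (q y))^2) integrable_on {z..L}"
    using square by (rule has_integral_integrable)
  show "integral {z..L} (\<lambda>y. (max 0 (q y))^2) \<le> n^3 / (3 * b)"
    using integral_unique[OF square] assms(1,2) by (simp add: q_def)
qed

context profile
begin

lemma energy_density_integrable_on: "energy_density n c z' G integrable_on {a..b}"
  unfolding energy_density_def
  by (intro mult_integrable_on set_integral_diff absolutely_integrable_on
      absolutely_integrable_continuous_real continuous_intros)

text \<open>Completing the square in \<open>G y - m\<close>, with \<open>m\<close> the average of \<open>G\<close>, bounds the energy lost by averaging;
  \<open>k\<close> is the weight at the midpoint, and the terms linear in \<open>G y - m\<close> integrate to 0.\<close>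

lemma energy_density_spread_ge:
  fixes a c :: real
  defines "k \<equiv> max 0 (a + 1/2 - z)" and "m \<equiv> unit_mean a G"
  assumes "y \<in> {a..a+1}"
  shows "energy_density n c z G y
      + (2 * n - 2 * m - 2 * c * k) * (m - G y) - c^2 * (y - (a + 1/2))^2
    \<le> energy_density n c z (spread n z a G) y"
proof -
  define w where "w = max 0 (y - z)"
  have "(w - k)^2 \<le> (y - (a + 1/2))^2"
    unfolding abs_le_square_iff[symmetric] by (simp add: w_def k_def)
  then have "c^2 * (w - k)^2 \<le> c^2 * (y - (a + 1/2))^2"
    by (intro mult_left_mono) auto
  moreover have "m * (2 * n - m - 2 * c * w) - G y * (2 * n - G y - 2 * c * w)
      = (G y - m + c * (w - k))^2 - c^2 * (w - k)^2 + (2 * n - 2 * m - 2 * c * k) * (m - G y)"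
    by algebra
  ultimately have averaging: "energy_density n c z G y
      + (2 * n - 2 * m - 2 * c * k) * (m - G y) - c^2 * (y - (a + 1/2))^2
      \<le> m * (2 * n - m - 2 * c * w)"
    unfolding energy_density_def w_def[symmetric]
    using zero_le_power2[of "G y - m + c * (w - k)"] by linarith
  have resetting: "m * (2 * n - m - 2 * c * w) \<le> n * (2 * n - n - 2 * c * w)" if "y \<le> z"
  proof -
    have "n * (2 * n - n) - m * (2 * n - m) = (n - m)^2"
      by algebra
    then have "m * (2 * n - m) \<le> n * (2 * n - n)"
      using zero_le_power2[of "n - m"] by linarith
    then show ?thesis
      using that by (simp add: w_def)
  qed
  show ?thesis
    using averaging resetting assms(3)
    by (cases "y \<le> z") (simp_all add: energy_density_def spread_def w_def m_def)
qed

lemma energy_spread_ge: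
  assumes "l \<le> a" "a + 1 \<le> L"
  shows "integral {l..L} (energy_density n c z G) - c^2 / 12
    \<le> integral {l..L} (energy_density n c z (spread n z a G))"
proof -
  define m where "m = unit_mean a G"
  define K where "K = 2 * n - 2 * m - 2 * c * max 0 (a + 1/2 - z)"
  define p where "p = (\<lambda>y. K * (m - G y) - c^2 * (y - (a + 1/2))^2)"
  have "(G has_integral m) {a..a+1}"
    unfolding m_def using integrable_on by (rule integrable_integral)
  moreover have "((\<lambda>_. m) has_integral m) {a..a+1}"
    using has_integral_const_real[of m a "a + 1"] by simp
  moreover have "((\<lambda>y. (y - (a + 1/2))^2) has_integral 1 / 12) {a..a+1}"
    using has_integral_centered_square[of a "a + 1"] by (simp add: add_divide_distrib)
  ultimately have "(p has_integral (K * (m - m) - c^2 * (1 / 12))) {a..a+1}"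
    unfolding p_def by (intro has_integral_diff has_integral_mult_right)
  then have "((\<lambda>y. if y \<in> {a..a+1} then p y else 0) has_integral - (c^2 / 12)) {l..L}"
    using assms by (subst has_integral_restrict) auto
  with energy_density_integrable_on
  have "((\<lambda>y. energy_density n c z G y + (if y \<in> {a..a+1} then p y else 0)) has_integral
      (integral {l..L} (energy_density n c z G) + (- (c^2 / 12)))) {l..L}"
    by (intro has_integral_add integrable_integral)
  moreover have "(energy_density n c z (spread n z a G) has_integral
      integral {l..L} (energy_density n c z (spread n z a G))) {l..L}"
    using profile.energy_density_integrable_on[OF profile_spread] by (rule integrable_integral)
  moreover have "energy_density n c z G y + (if y \<in> {a..a+1} then p y else 0)
      \<le> energy_density n c z (spread n z a G) y" for y
    using energy_density_spread_ge[of y a c] eq_height[of y]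
    by (auto simp: p_def K_def m_def energy_density_def spread_def)
  ultimately have "integral {l..L} (energy_density n c z G) + (- (c^2 / 12))
      \<le> integral {l..L} (energy_density n c z (spread n z a G))"
    by (rule has_integral_le)
  then show ?thesis
    by simp
qed

lemma energy_split:
  assumes "l \<le> z" "z \<le> L"
  shows "integral {l..L} (energy_density n c z G)
    = (z - l) * n^2 + integral {z..L} (energy_density n c z G)"
proof -
  have "integral {l..z} (energy_density n c z G) = integral {l..z} (\<lambda>_. n^2)"
    by (rule integral_cong) (simp add: energy_density_def eq_height power2_eq_square)
  then show ?thesis
    using Henstock_Kurzweil_Integration.integral_combine[OF assms energy_density_integrable_on, of c z]
      assms(1)
    by simp
qed

lemma energy_density_le:
  assumes "z \<le> y"
  shows "energy_density n c z G y
    \<le> (max 0 (n - b * (y - z)))^2 - 2 * (c - b) * (G y * (y - z))"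
proof -
  define q where "q = n - b * (y - z)"
  have "2 * (q * G y) \<le> 2 * (max 0 q * G y)"
    using nonneg by (intro mult_left_mono mult_right_mono) auto
  moreover have "(max 0 q)^2 - 2 * (max 0 q * G y) + (G y)^2 = (max 0 q - G y)^2"
    by algebra
  moreover have "energy_density n c z G y = 2 * (q * G y) - (G y)^2 - 2 * (c - b) * (G y * (y - z))"
    using assms by (simp add: energy_density_def q_def power2_eq_square algebra_simps)
  ultimately show ?thesis
    unfolding q_def[symmetric] using zero_le_power2[of "max 0 q - G y"] by linarith
qed

lemma mult_diff_integrable_on: "(\<lambda>y. G y * (y - z')) integrable_on {a..b}"
  by (intro mult_integrable_on absolutely_integrable_continuous_real continuous_intros)

lemma energy_le:
  assumes "b > 0" "l \<le> z" "z \<le> L"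
  shows "integral {l..L} (energy_density n c z G)
    \<le> (z - l) * n^2 + n^3 / (3 * b) - 2 * (c - b) * integral {z..L} (\<lambda>y. G y * (y - z))"
proof -
  have "n \<ge> 0"
    using order_trans[OF nonneg le_height] .
  note square = integral_positive_part_square_le[OF assms(1) this assms(3)]
  have "integral {z..L} (energy_density n c z G)
      \<le> integral {z..L} (\<lambda>y. (max 0 (n - b * (y - z)))^2 - 2 * (c - b) * (G y * (y - z)))"
    by (intro integral_le energy_density_integrable_on integrable_diff square(1)
        integrable_on_mult_right mult_diff_integrable_on energy_density_le) simp
  also have "\<dots> = integral {z..L} (\<lambda>y. (max 0 (n - b * (y - z)))^2)
      - 2 * (c - b) * integral {z..L} (\<lambda>y. G y * (y - z))"
    by (simp add: Henstock_Kurzweil_Integration.integral_diff square(1) mult_diff_integrable_on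
        integrable_on_mult_right)
  finally show ?thesis
    using square(2) by (simp add: energy_split[OF assms(2,3)])
qed

lemma first_moment_ge:
  assumes "e \<ge> 0"
  shows "e * integral {z+e..L} G + e * integral {z+2*e..L} G
    \<le> integral {z..L} (\<lambda>y. G y * (y - z))"
proof -
  have tail_integral: "((\<lambda>y. if y \<in> {z+x..L} then e * G y else 0) has_integral e * integral {z+x..L} G) {z..L}"
    if "x \<ge> 0" for x
    using that by (subst has_integral_restrict)
      (auto intro: has_integral_mult_right integrable_integral integrable_on)
  moreover have "(if y \<in> {z+e..L} then e * G y else 0) + (if y \<in> {z+2*e..L} then e * G y else 0)
      \<le> G y * (y - z)" if "y \<in> {z..L}" for y
  proof -
    have "(if y \<in> {z+e..L} then e * G y else 0) + (if y \<in> {z+2*e..L} then e * G y else 0)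
        = G y * ((if y \<in> {z+e..L} then e else 0) + (if y \<in> {z+2*e..L} then e else 0))"
      by simp
    also have "\<dots> \<le> G y * (y - z)"
      using assms that nonneg by (intro mult_left_mono) auto
    finally show ?thesis .
  qed
  ultimately show ?thesis
    using assms
    by (intro has_integral_le[OF has_integral_add[OF tail_integral[of e] tail_integral[of "2 * e"]]
          integrable_integral[OF mult_diff_integrable_on]]) auto
qed

end

section \<open>Domination of the excess by a profile\<close>

definition tail_dominates :: "(real \<Rightarrow> real) \<Rightarrow> real \<Rightarrow> real \<Rightarrow> (real \<Rightarrow> real) \<Rightarrow> bool" where
  "tail_dominates G l L mu \<longleftrightarrow> (\<forall>y\<in>{l..L}. excess mu y \<le> integral {y..L} G)"

context profile
begin

lemma tail_dominates_extend_left: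
  assumes dist: "is_dist mu" and dominates: "tail_dominates G z L mu"
    and "z \<le> L" and mass_le: "mass mu {l<..} \<le> n"
  shows "tail_dominates G l L mu"
  unfolding tail_dominates_def
proof
  fix y assume y_in: "y \<in> {l..L}"
  show "excess mu y \<le> integral {y..L} G"
  proof (cases "z \<le> y")
    case True
    then show ?thesis
      using dominates y_in by (simp add: tail_dominates_def)
  next
    case False
    then have "y \<le> z"
      by simp
    have "mass mu {y<..} \<le> mass mu {l<..}"
      using y_in by (intro mass_mono[OF dist]) auto
    then have "(z - y) * mass mu {y<..} \<le> (z - y) * n"
      using mass_le \<open>y \<le> z\<close> by (intro mult_left_mono) auto
    moreover have "integral {y..z} G = (z - y) * n"
      using \<open>y \<le> z\<close> eq_height integral_cong[of "{y..z}" G "\<lambda>_. n"] by simp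
    moreover have "excess mu z \<le> integral {z..L} G"
      using dominates \<open>z \<le> L\<close> by (simp add: tail_dominates_def)
    ultimately show ?thesis
      using excess_le_excess_plus_mass[OF dist \<open>y \<le> z\<close>] integral_split[OF \<open>y \<le> z\<close> \<open>z \<le> L\<close>] by simp
  qed
qed

lemma tail_dominates_spread:
  assumes move: "is_move v" and dist: "is_dist mu" "is_dist (apply_move v mu)"
    and dominates: "tail_dominates G l L mu" and "l \<le> fst v" "fst v + 1 \<le> L"
  shows "tail_dominates (spread n z (fst v) G) l L (apply_move v mu)"
  unfolding tail_dominates_def
proof
  let ?a = "fst v"
  fix y assume y_in: "y \<in> {l..L}"
  have dominates: "excess mu x \<le> integral {x..L} G" if "l \<le> x" "x \<le> L" for x
    using dominates that by (simp add: tail_dominates_def)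
  consider (outside) "y \<le> ?a \<or> ?a + 1 \<le> y" | (inside) "?a \<le> y" "y \<le> ?a + 1"
    by linarith
  then show "excess (apply_move v mu) y \<le> integral {y..L} (spread n z ?a G)"
  proof cases
    case outside
    then have "excess (apply_move v mu) y \<le> integral {y..L} G"
      using dominates[of y] y_in by (simp add: excess_apply_move_outside[OF move dist(1)])
    also have "\<dots> \<le> integral {y..L} (spread n z ?a G)"
      using outside integral_spread_left[of y ?a L] integral_spread_right[of ?a y L] \<open>?a + 1 \<le> L\<close>
      by auto
    finally show ?thesis .
  next
    case inside
    have "excess (apply_move v mu) y \<le> (?a + 1 - y) * excess mu ?a + (y - ?a) * excess mu (?a + 1)"
      using excess_apply_move_le_chord[OF move dist] inside by simp
    also have "\<dots> \<le> (?a + 1 - y) * (unit_mean ?a G + integral {?a+1..L} G)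
        + (y - ?a) * integral {?a+1..L} G"
      using dominates[of ?a] dominates[of "?a + 1"] integral_split[of ?a "?a + 1" L] \<open>l \<le> ?a\<close> \<open>?a + 1 \<le> L\<close> inside
      by (intro add_mono mult_left_mono) auto
    also have "\<dots> = (?a + 1 - y) * unit_mean ?a G + integral {?a+1..L} G"
      by (simp add: algebra_simps)
    also have "\<dots> \<le> integral {y..L} (spread n z ?a G)"
      using inside \<open>?a + 1 \<le> L\<close> by (intro integral_spread_inside) auto
    finally show ?thesis .
  qed
qed

lemma exists_dominating_profile_apply_move:
  assumes move: "is_move v" and dist: "is_dist mu" "is_dist (apply_move v mu)"
    and dominates: "tail_dominates G l L mu" and "fst v + 1 \<le> L" "l + 1 \<le> z" "z \<le> L"
    and mass_le: "mass (apply_move v mu) {l<..} \<le> n"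
  obtains H where "profile n z H" and "tail_dominates H l L (apply_move v mu)"
    and "integral {l..L} (energy_density n c z G) - (if center v > l then c^2 / 12 else 0)
      \<le> integral {l..L} (energy_density n c z H)"
proof (cases "fst v \<le> l")
  case True
  show thesis
  proof (rule that[of G])
    have "tail_dominates G z L (apply_move v mu)"
      using dominates True \<open>l + 1 \<le> z\<close>
      by (simp add: tail_dominates_def excess_apply_move_outside[OF move dist(1)])
    then show "tail_dominates G l L (apply_move v mu)"
      by (rule tail_dominates_extend_left[OF dist(2) _ \<open>z \<le> L\<close> mass_le])
  qed (use profile_axioms in auto)
next
  case False
  then have "l \<le> fst v"
    by simp
  show thesis
  proof (rule that[of "spread n z (fst v) G"])
    show "tail_dominates (spread n z (fst v) G) l L (apply_move v mu)"
      by (rule tail_dominates_spread[OF move dist dominates \<open>l \<le> fst v\<close> \<open>fst v + 1 \<le> L\<close>])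
    show "integral {l..L} (energy_density n c z G) - (if center v > l then c^2 / 12 else 0)
        \<le> integral {l..L} (energy_density n c z (spread n z (fst v) G))"
      using energy_spread_ge[OF \<open>l \<le> fst v\<close> \<open>fst v + 1 \<le> L\<close>, of c] \<open>l \<le> fst v\<close>
      by (simp add: center_def)
  qed (rule profile_spread)
qed

lemma first_moment_ge_mass:
  assumes dist: "is_dist mu" and dominates: "tail_dominates G z L mu" and "e \<ge> 0" "z + 3 * e \<le> L"
  shows "3 * e^2 * mass mu {z + 3 * e<..} \<le> integral {z..L} (\<lambda>y. G y * (y - z))"
proof -
  have tail_ge: "(3 * e - x) * mass mu {z + 3 * e<..} \<le> integral {z+x..L} G" if "x \<in> {0..3 * e}" for x
  proof -
    have "(3 * e - x) * mass mu {z + 3 * e<..} \<le> excess mu (z + x)"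
      using mass_le_excess[OF dist, of "z + x" "z + 3 * e"] that by simp
    also have "\<dots> \<le> integral {z+x..L} G"
      using dominates that \<open>z + 3 * e \<le> L\<close> by (simp add: tail_dominates_def)
    finally show ?thesis .
  qed
  have "3 * e^2 * mass mu {z + 3 * e<..}
      = e * ((3 * e - e) * mass mu {z + 3 * e<..}) + e * ((3 * e - 2 * e) * mass mu {z + 3 * e<..})"
    by algebra
  also have "\<dots> \<le> e * integral {z+e..L} G + e * integral {z+2*e..L} G"
    using \<open>e \<ge> 0\<close> by (intro add_mono mult_left_mono tail_ge) auto
  also have "\<dots> \<le> integral {z..L} (\<lambda>y. G y * (y - z))"
    by (rule first_moment_ge[OF \<open>e \<ge> 0\<close>])
  finally show ?thesis .
qed

end

lemma profile_step: "n \<ge> 0 \<Longrightarrow> profile n z (\<lambda>y. if y \<le> z then n else 0)"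
  by unfold_locales (auto simp: antimono_def)

lemma energy_step_ge:
  assumes "n \<ge> 0" "l \<le> z" "z \<le> L"
  shows "(z - l) * n^2 \<le> integral {l..L} (energy_density n c z (\<lambda>y. if y \<le> z then n else 0))"
proof -
  interpret profile n z "\<lambda>y. if y \<le> z then n else 0"
    by (rule profile_step[OF assms(1)])
  have "0 \<le> integral {z..L} (energy_density n c z (\<lambda>y. if y \<le> z then n else 0))"
    by (intro integral_nonneg energy_density_integrable_on) (auto simp: energy_density_def)
  then show ?thesis
    by (simp add: energy_split[OF assms(2,3)])
qed

section \<open>Sequences of moves\<close>

lemma seq_dist_0: "seq_dist mu0 vs 0 = mu0"
  by (simp add: seq_dist_def)

lemma seq_dist_Suc: "seq_dist mu0 vs (Suc i) = apply_move (vs ! i) (seq_dist mu0 vs i)"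
  by (simp add: seq_dist_def apply_move_def add.assoc)

lemma mu_max_le_iff:
  "mu_max mu0 vs A \<le> x \<longleftrightarrow> (\<forall>i\<le>length vs. mass (seq_dist mu0 vs i) A \<le> x)"
  unfolding mu_max_def by (subst Max_le_iff) auto

lemma mass_le_mu_max: "i \<le> length vs \<Longrightarrow> mass (seq_dist mu0 vs i) A \<le> mu_max mu0 vs A"
  using mu_max_le_iff by blast

definition moves_beyond :: "(real \<times> (real \<Rightarrow> real)) list \<Rightarrow> real \<Rightarrow> nat \<Rightarrow> nat" where
  "moves_beyond vs r i = card {j. j < i \<and> center (vs ! j) > r}"

lemma moves_beyond_0: "moves_beyond vs r 0 = 0"
  by (simp add: moves_beyond_def)

lemma moves_beyond_Suc:
  "moves_beyond vs r (Suc i) = moves_beyond vs r i + (if center (vs ! i) > r then 1 else 0)"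
proof -
  have "{j. j < Suc i \<and> center (vs ! j) > r} =
    (if center (vs ! i) > r then insert i {j. j < i \<and> center (vs ! j) > r}
     else {j. j < i \<and> center (vs ! j) > r})"
    by (auto simp: less_Suc_eq)
  then show ?thesis
    by (simp add: moves_beyond_def)
qed

lemma moves_beyond_le_mu_max:
  assumes "weight_constrained mu0 vs" "i \<le> length vs"
  shows "real (moves_beyond vs r i) \<le> mu_max mu0 vs {r<..}"
proof -
  have "moves_beyond vs r i \<le> moves_beyond vs r (length vs)"
    unfolding moves_beyond_def using assms(2) by (intro card_mono) auto
  moreover have "real (moves_beyond vs r (length vs)) \<le> mu_max mu0 vs {r<..}"
    using assms(1) by (simp add: weight_constrained_def moves_beyond_def)
  ultimately show ?thesis
    by linarith
qed

lemma cube_plus_le_linear: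
  fixes s :: real
  assumes "1/2 \<le> s" "s \<le> 9/4"
  shows "s^3 + 3/2 \<le> 6 * s"
proof -
  have "(s + 11/4) * ((s - 1/2) * (s - 9/4)) \<le> 0"
    using assms by (intro mult_nonneg_nonpos mult_nonneg_nonpos) auto
  moreover have "(s + 11/4) * ((s - 1/2) * (s - 9/4)) = s^3 - 103/16 * s + 99/32"
    by (simp add: power3_eq_cube field_simps)
  ultimately show ?thesis
    using assms by simp
qed

locale move_sequence =
  fixes mu0 :: "real \<Rightarrow> real" and vs :: "(real \<times> (real \<Rightarrow> real)) list"
  assumes valid: "valid_seq mu0 vs"
begin

abbreviation mu :: "nat \<Rightarrow> real \<Rightarrow> real" where
  "mu \<equiv> seq_dist mu0 vs"

lemma is_dist_mu: "i \<le> length vs \<Longrightarrow> is_dist (mu i)"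
  using valid by (simp add: valid_seq_def)

lemma is_dist_mu0: "is_dist mu0"
  using is_dist_mu[of 0] by (simp add: seq_dist_0)

lemma is_move_nth: "i < length vs \<Longrightarrow> is_move (vs ! i)"
  using valid by (simp add: valid_seq_def)

lemma mu_max_eq_0_iff:
  "mu_max mu0 vs {a<..} = 0 \<longleftrightarrow> (\<forall>i\<le>length vs. excess (mu i) a = 0)"
proof -
  have nonneg: "0 \<le> mass (mu i) {a<..}" if "i \<le> length vs" for i
    by (rule mass_nonneg[OF is_dist_mu[OF that]])
  then have "0 \<le> mu_max mu0 vs {a<..}"
    using order_trans[OF nonneg mass_le_mu_max] by blast
  then have "mu_max mu0 vs {a<..} = 0 \<longleftrightarrow> (\<forall>i\<le>length vs. mass (mu i) {a<..} = 0)"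
    using nonneg mu_max_le_iff[of mu0 vs "{a<..}" 0] by (auto intro: order_antisym)
  then show ?thesis
    by (simp add: mass_eq_0_iff_excess_eq_0 is_dist_mu)
qed

lemma excess_beyond_moves_eq_0:
  assumes "excess mu0 r = 0" "i \<le> length vs"
  shows "excess (mu i) (r + 1/2 + moves_beyond vs r i) = 0"
  using assms(2)
proof (induction i)
  case 0
  show ?case
    using excess_eq_0_mono[OF is_dist_mu0 assms(1)] by (simp add: seq_dist_0 moves_beyond_0)
next
  case (Suc i)
  define y where "y = r + 1/2 + moves_beyond vs r i"
  have dist: "is_dist (mu i)" "is_dist (apply_move (vs ! i) (mu i))" and move: "is_move (vs ! i)"
    using Suc.prems is_dist_mu[of i] is_dist_mu[of "Suc i"] is_move_nth by (auto simp: seq_dist_Suc)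
  have excess_0: "excess (mu i) y = 0"
    using Suc by (simp add: y_def)
  show ?case
  proof (cases "center (vs ! i) > r")
    case True
    then show ?thesis
      using excess_apply_move_shift_eq_0[OF move dist excess_0]
      by (simp add: seq_dist_Suc moves_beyond_Suc y_def ac_simps)
  next
    case False
    then have "fst (vs ! i) + 1 \<le> y"
      by (simp add: center_def y_def)
    then show ?thesis
      using False excess_apply_move_outside[OF move dist(1)] excess_0
      by (simp add: seq_dist_Suc moves_beyond_Suc y_def)
  qed
qed

lemma dominating_profile_exists:
  assumes excess_0: "excess mu0 r = 0" and "n \<ge> 0" and max_le: "mu_max mu0 vs {r<..} \<le> n"
    and "r + 1 \<le> L" and L_bound: "\<And>v. v \<in> set vs \<Longrightarrow> fst v + 1 \<le> L"
    and "i \<le> length vs"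
  shows "\<exists>G. profile n (r + 1) G \<and> tail_dominates G r L (mu i) \<and>
    n^2 - c^2 / 12 * moves_beyond vs r i \<le> integral {r..L} (energy_density n c (r + 1) G)"
  using \<open>i \<le> length vs\<close>
proof (induction i)
  case 0
  let ?G = "\<lambda>y. if y \<le> r + 1 then n else 0"
  have step: "profile n (r + 1) ?G"
    by (rule profile_step[OF \<open>n \<ge> 0\<close>])
  have "tail_dominates ?G r L (mu 0)"
    using excess_eq_0_mono[OF is_dist_mu0 excess_0] profile.nonneg[OF step]
    by (auto simp: tail_dominates_def seq_dist_0 intro!: integral_nonneg profile.integrable_on[OF step])
  then show ?case
    using step energy_step_ge[of n r "r + 1" L c] \<open>n \<ge> 0\<close> \<open>r + 1 \<le> L\<close>
    by (intro exI[of _ ?G]) (simp add: moves_beyond_0)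
next
  case (Suc i)
  have dist: "is_dist (mu i)" "is_dist (apply_move (vs ! i) (mu i))" and move: "is_move (vs ! i)"
    using Suc.prems is_dist_mu[of i] is_dist_mu[of "Suc i"] is_move_nth by (auto simp: seq_dist_Suc)
  have "fst (vs ! i) + 1 \<le> L"
    using L_bound Suc.prems by simp
  have mass_le: "mass (apply_move (vs ! i) (mu i)) {r<..} \<le> n"
    using order_trans[OF mass_le_mu_max[OF Suc.prems] max_le] by (simp flip: seq_dist_Suc)
  obtain G where "profile n (r + 1) G" and dominates: "tail_dominates G r L (mu i)"
    and energy: "n^2 - c^2 / 12 * moves_beyond vs r i \<le> integral {r..L} (energy_density n c (r + 1) G)"
    using Suc by auto
  interpret profile n "r + 1" G by fact
  obtain H where "profile n (r + 1) H" "tail_dominates H r L (mu (Suc i))"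
    and "integral {r..L} (energy_density n c (r + 1) G) - (if center (vs ! i) > r then c^2 / 12 else 0)
      \<le> integral {r..L} (energy_density n c (r + 1) H)"
    using exists_dominating_profile_apply_move[OF move dist dominates \<open>fst (vs ! i) + 1 \<le> L\<close> order_refl
        \<open>r + 1 \<le> L\<close> mass_le]
    unfolding seq_dist_Suc by blast
  then show ?case
    using energy by (intro exI[of _ H]) (auto simp: moves_beyond_Suc distrib_left split: if_splits)
qed

lemma mass_beyond_le:
  assumes constrained: "weight_constrained mu0 vs" and "excess mu0 r = 0" "n \<ge> 0"
    and max_le: "mu_max mu0 vs {r<..} \<le> n"
    and slopes: "0 < b" "b \<le> c" and "e \<ge> 0" and "i \<le> length vs"
  shows "6 * (c - b) * e^2 * mass (mu i) {r + 1 + 3 * e<..} \<le> n^3 / (3 * b) + c^2 / 12 * n"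
proof -
  define L where "L = Max (insert (r + 1 + 3 * e) ((\<lambda>v. fst v + 1) ` set vs))"
  have L_bounds: "r + 1 + 3 * e \<le> L" "\<And>v. v \<in> set vs \<Longrightarrow> fst v + 1 \<le> L"
    unfolding L_def by auto
  then have "r + 1 \<le> L"
    using \<open>e \<ge> 0\<close> by linarith
  obtain G where "profile n (r + 1) G" and dominates: "tail_dominates G r L (mu i)"
    and energy_ge: "n^2 - c^2 / 12 * moves_beyond vs r i \<le> integral {r..L} (energy_density n c (r + 1) G)"
    using dominating_profile_exists[OF assms(2-4) \<open>r + 1 \<le> L\<close> L_bounds(2) \<open>i \<le> length vs\<close>] by blast
  interpret profile n "r + 1" G by fact
  define M where "M = integral {r+1..L} (\<lambda>y. G y * (y - (r + 1)))"
  have "tail_dominates G (r + 1) L (mu i)"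
    using dominates by (simp add: tail_dominates_def)
  then have "3 * e^2 * mass (mu i) {r + 1 + 3 * e<..} \<le> M"
    unfolding M_def using \<open>e \<ge> 0\<close> L_bounds(1) by (intro first_moment_ge_mass is_dist_mu \<open>i \<le> length vs\<close>)
  then have "2 * (c - b) * (3 * e^2 * mass (mu i) {r + 1 + 3 * e<..}) \<le> 2 * (c - b) * M"
    using slopes by (intro mult_left_mono) auto
  moreover have "integral {r..L} (energy_density n c (r + 1) G) \<le> n^2 + n^3 / (3 * b) - 2 * (c - b) * M"
    using energy_le[OF slopes(1) _ \<open>r + 1 \<le> L\<close>, of r c] by (simp add: M_def)
  moreover have "c^2 / 12 * moves_beyond vs r i \<le> c^2 / 12 * n"
    using moves_beyond_le_mu_max[OF constrained \<open>i \<le> length vs\<close>, of r] max_le by (intro mult_left_mono) auto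
  moreover have "6 * (c - b) * e^2 * mass (mu i) {r + 1 + 3 * e<..}
      = 2 * (c - b) * (3 * e^2 * mass (mu i) {r + 1 + 3 * e<..})"
    by simp
  ultimately show ?thesis
    using energy_ge by linarith
qed

lemma mu_max_beyond_triple_le:
  assumes "weight_constrained mu0 vs" and "excess mu0 r = 0" and "s \<ge> 9/4"
    and "mu_max mu0 vs {r<..} \<le> s^3"
  shows "mu_max mu0 vs {r + 3 * s<..} \<le> (s / 2)^3"
  unfolding mu_max_le_iff
proof (intro allI impI)
  fix i assume "i \<le> length vs"
  let ?m = "mass (mu i) {r + 3 * s<..}"
  have "?m \<ge> 0"
    by (intro mass_nonneg is_dist_mu \<open>i \<le> length vs\<close>)
  have "6 * (3 * s^2 - 3/4 * s^2) * (s - 1/3)^2 * mass (mu i) {r + 1 + 3 * (s - 1/3)<..}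
      \<le> (s^3)^3 / (3 * (3/4 * s^2)) + (3 * s^2)^2 / 12 * s^3"
    using assms \<open>i \<le> length vs\<close> by (intro mass_beyond_le) auto
  also have "\<dots> = 43/36 * s^7"
    using assms(3) by (simp add: field_simps power_numeral_reduce)
  finally have upper: "27/2 * s^2 * (s - 1/3)^2 * ?m \<le> 43/36 * s^7"
    by (simp add: algebra_simps)
  have "(23/27 * s)^2 \<le> (s - 1/3)^2"
    using assms(3) by (intro power_mono) auto
  then have "27/2 * s^2 * (23/27 * s)^2 * ?m \<le> 27/2 * s^2 * (s - 1/3)^2 * ?m"
    using \<open>?m \<ge> 0\<close> by (intro mult_right_mono mult_left_mono) auto
  with upper have "s^4 * (529/54 * ?m) \<le> s^4 * (43/36 * s^3)"
    by (simp add: power_numeral_reduce field_simps)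
  then have "529/54 * ?m \<le> 43/36 * s^3"
    by (rule mult_left_le_imp_le) (use assms(3) in simp)
  moreover have "(s / 2)^3 = s^3 / 8" "s^3 \<ge> 0"
    using assms(3) by (simp_all add: power_divide)
  ultimately show "?m \<le> (s / 2)^3"
    by linarith
qed

lemma mu_max_beyond_eq_0:
  assumes constrained: "weight_constrained mu0 vs"
    and "excess mu0 r = 0" and "s \<ge> 1/2" and "mu_max mu0 vs {r<..} \<le> s^3" and "s \<le> 9/4 * 2^k"
  shows "mu_max mu0 vs {r + 6 * s - 1<..} = 0"
  using assms(2-5)
proof (induction k arbitrary: r s)
  case 0
  have "excess (mu i) (r + 6 * s - 1) = 0" if i: "i \<le> length vs" for i
  proof (rule excess_eq_0_mono[OF is_dist_mu[OF i] excess_beyond_moves_eq_0[OF 0(1) i]])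
    show "r + 1/2 + moves_beyond vs r i \<le> r + 6 * s - 1"
      using moves_beyond_le_mu_max[OF constrained i, of r] 0 cube_plus_le_linear[of s] by simp
  qed
  then show ?case
    by (simp add: mu_max_eq_0_iff)
next
  case (Suc k)
  show ?case
  proof (cases "s \<le> 9/4")
    case True
    then have "s \<le> 9/4 * 2^k"
      using one_le_power[of "2::real" k] by linarith
    then show ?thesis
      using Suc by simp
  next
    case False
    have "excess mu0 (r + 3 * s) = 0"
      using excess_eq_0_mono[OF is_dist_mu0 Suc.prems(1)] Suc.prems(2) by simp
    moreover have "mu_max mu0 vs {r + 3 * s<..} \<le> (s / 2)^3"
      using Suc.prems False by (intro mu_max_beyond_triple_le[OF constrained]) auto
    ultimately have "mu_max mu0 vs {r + 3 * s + 6 * (s / 2) - 1<..} = 0"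
      using False Suc.prems by (intro Suc.IH) auto
    then show ?thesis
      by (simp add: add.commute)
  qed
qed

end

theorem mainTheorem3:
  fixes r n :: real
    and mu0 :: "real \<Rightarrow> real"
    and vs :: "(real \<times> (real \<Rightarrow> real)) list"
  assumes "n \<ge> 1/5"
    and "valid_seq mu0 vs"
    and "weight_constrained mu0 vs"
    and "mass mu0 {r<..} = 0"
    and "mu_max mu0 vs {r<..} \<le> n"
  shows "mu_max mu0 vs {r + 6 * n powr (1/3) - 1<..} = 0"
proof -
  interpret move_sequence mu0 vs
    by unfold_locales fact
  define s where "s = n powr (1/3)"
  have s_cube: "s^3 = n"
    using assms(1) by (simp add: s_def powr_power)
  then have "(1/2)^3 \<le> s^3"
    using assms(1) by (simp add: power3_eq_cube)
  then have "s \<ge> 1/2"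
    using power_mono_iff[of "1/2" s 3] by (simp add: s_def)
  moreover have "excess mu0 r = 0"
    using assms(4) by (simp add: mass_eq_0_iff_excess_eq_0 is_dist_mu0)
  moreover obtain k where "4/9 * s < 2^k"
    using real_arch_pow[of 2 "4/9 * s"] by auto
  ultimately have "mu_max mu0 vs {r + 6 * s - 1<..} = 0"
    using assms(5) s_cube by (intro mu_max_beyond_eq_0[OF assms(3), of r s k]) auto
  then show ?thesis
    by (simp add: s_def)
qed

end
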